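(* Let $\mathbb{P}$ be a Borel probability measure on a normed vector space $(\Omega,\|\cdot\|_\Omega)$. Assume that $g$ is a non-negative, continuous negative definite kernel on $\Omega\times\Omega$ such that $g(x,y)=g_0(\|x-y\|_\Omega)$, with $g_0(x)\asymp|x|^{\alpha}$ for some $\alpha>0$, and $|\mathsf{E}_{\mathbb{P}}[g_0(\|X\|_\Omega)]|<\infty$. Let $$S^{\mathrm{ker}}_g(\mathbb{P},y) := \frac12\mathsf{E}_{\mathbb{P},\mathbb{P}}[g(X,Y)] - \mathsf{E}_{\mathbb{P}}[g(X,y)].$$ Then $|S^{\mathrm{ker}}_g(\mathbb{P},y)|\asymp\|y\|_\Omega^{\alpha}$ (as functions of $y\in\Omega$).
   Context: A negative definite kernel on a non-empty set $\Omega$ is a real-valued function $g$ on $\Omega\times\Omega$ that is symmetric in its arguments and satisfies $\sum_{i=1}^n\sum_{j=1}^n a_ia_jg(x_i,x_j)\le 0$ for all positive integers $n$, all $a_1,\dots,a_n\in\mathbb{R}$ with $\sum_i a_i=0$ and all $x_1,\dots,x_n\in\Omega$. $\mathsf{E}_{\mathbb{P}}$ is expectation for $X\sim\mathbb{P}$; $\mathsf{E}_{\mathbb{P},\mathbb{P}}$ is expectation for independent $X,Y\sim\mathbb{P}$. $f(x)\asymp g(x)$ means that there exist constants $0<c<C<\infty$ and $x_0>0$ such that $cg(x)\le f(x)\le Cg(x)$ for all $x$ with $\|x\|>x_0$. *)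

theory Defs
  imports "HOL-Probability.Probability"
begin

definition negative_definite_kernel :: "'a set \<Rightarrow> ('a \<Rightarrow> 'a \<Rightarrow> real) \<Rightarrow> bool" where
  "negative_definite_kernel \<Omega> g \<longleftrightarrow>
     \<Omega> \<noteq> {} \<and>
     (\<forall>x\<in>\<Omega>. \<forall>y\<in>\<Omega>. g x y = g y x) \<and>
     (\<forall>n::nat. \<forall>(a :: nat \<Rightarrow> real) (x :: nat \<Rightarrow> 'a).
        n > 0 \<longrightarrow> (\<Sum>i=1..n. a i) = 0 \<longrightarrow> (\<forall>i\<in>{1..n}. x i \<in> \<Omega>) \<longrightarrow>
        (\<Sum>i=1..n. \<Sum>j=1..n. a i * a j * g (x i) (x j)) \<le> 0)"

(* Two-sided comparison of f and h for arguments of large norm; S is the common domain of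
   f and h, so that a function on the half-line can be compared on {0..} only. *)
definition asymp_equiv_on ::
    "'a::real_normed_vector set \<Rightarrow> ('a \<Rightarrow> real) \<Rightarrow> ('a \<Rightarrow> real) \<Rightarrow> bool" where
  "asymp_equiv_on S f h \<longleftrightarrow>
     (\<exists>c C x0 :: real. 0 < c \<and> c < C \<and> 0 < x0 \<and>
        (\<forall>x\<in>S. norm x > x0 \<longrightarrow> c * h x \<le> f x \<and> f x \<le> C * h x))"

(* The expectation over an independent pair is the integral against the product measure. *)
definition kernel_score :: "('a \<Rightarrow> 'a \<Rightarrow> real) \<Rightarrow> 'a measure \<Rightarrow> 'a \<Rightarrow> real" where
  "kernel_score g P y =
     1 / 2 * (\<integral>z. g (fst z) (snd z) \<partial>(P \<Otimes>\<^sub>M P)) - (\<integral>x. g x y \<partial>P)"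

end

theory Submission
  imports Defs
begin

text \<open>
  The first term of the score does not depend on \<open>y\<close>, so only the growth of the potential
  \<open>y \<mapsto> E g(X, y)\<close> matters. Everything is compared up to additive constants: a function that lies
  between \<open>a \<parallel>y\<parallel>\<^sup>\<alpha> - A\<close> and \<open>B \<parallel>y\<parallel>\<^sup>\<alpha> + A\<close> with \<open>a > 0\<close> is of order \<open>\<parallel>y\<parallel>\<^sup>\<alpha>\<close>
  (\<open>asymp_equiv_on_of_affine_bounds\<close>), and such bounds survive the addition of a constant.

  By continuity \<open>g\<^sub>0\<close> is bounded on compact intervals, so its asymptotic behaviour turns into
  affine bounds in \<open>t\<^sup>\<alpha>\<close> that hold for all \<open>t \<ge> 0\<close> (\<open>affine_bounds_of_asymp_equiv_on\<close>). They give
  \<open>E \<parallel>X\<parallel>\<^sup>\<alpha> < \<infinity>\<close> from \<open>E g\<^sub>0(\<parallel>X\<parallel>) < \<infinity>\<close>. The quasi-triangle inequality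
  \<open>\<parallel>x + y\<parallel>\<^sup>\<alpha> \<le> 2\<^sup>\<alpha> (\<parallel>x\<parallel>\<^sup>\<alpha> + \<parallel>y\<parallel>\<^sup>\<alpha>)\<close>, used once for \<open>x - y\<close> and once for
  \<open>y = x - (x - y)\<close>, traps \<open>\<parallel>x - y\<parallel>\<^sup>\<alpha>\<close> between affine functions of \<open>\<parallel>y\<parallel>\<^sup>\<alpha>\<close> whose
  constant terms are multiples of \<open>\<parallel>x\<parallel>\<^sup>\<alpha>\<close>. Integrating over \<open>x\<close> yields the required bounds for
  the potential (\<open>potential_affine_bounds\<close>).
\<close>

section \<open>Growth up to additive constants\<close>

lemma norm_add_powr_le:
  fixes x y :: "'a::real_normed_vector"
  assumes "\<alpha> \<ge> 0"
  shows "norm (x + y) powr \<alpha> \<le> 2 powr \<alpha> * (norm x powr \<alpha> + norm y powr \<alpha>)"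
proof -
  define m where "m = max (norm x) (norm y)"
  have "norm (x + y) \<le> 2 * m"
    using norm_triangle_ineq[of x y] by (simp add: m_def)
  then have "norm (x + y) powr \<alpha> \<le> (2 * m) powr \<alpha>"
    using assms by (intro powr_mono2) auto
  also have "\<dots> = 2 powr \<alpha> * m powr \<alpha>"
    by (rule powr_mult)
  also have "m powr \<alpha> \<le> norm x powr \<alpha> + norm y powr \<alpha>"
    by (simp add: m_def max_def)
  finally show ?thesis
    by simp
qed

text \<open>
  Once \<open>\<parallel>y\<parallel>\<^sup>\<alpha>\<close> exceeds both \<open>1\<close> and \<open>2 A / a\<close>, the constant \<open>A\<close> is absorbed: into half of the
  leading term below, and into an enlarged leading coefficient above.
\<close>

lemma asymp_equiv_on_of_affine_bounds:
  fixes f :: "'a::real_normed_vector \<Rightarrow> real"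
  assumes "\<alpha> > 0" "a > 0" "A \<ge> 0"
    and lower: "\<And>y. y \<in> S \<Longrightarrow> a * norm y powr \<alpha> - A \<le> f y"
    and upper: "\<And>y. y \<in> S \<Longrightarrow> f y \<le> B * norm y powr \<alpha> + A"
  shows "asymp_equiv_on S f (\<lambda>y. norm y powr \<alpha>)"
proof -
  define T where "T = max 1 (2 * A / a)"
  have T: "T \<ge> 1" "2 * A / a \<le> T"
    by (auto simp: T_def)
  have "a / 2 * norm y powr \<alpha> \<le> f y \<and> f y \<le> (\<bar>B\<bar> + A + a) * norm y powr \<alpha>"
    if "y \<in> S" and far: "norm y > T powr (1 / \<alpha>)" for y
  proof -
    define t where "t = norm y powr \<alpha>"
    have "(T powr (1 / \<alpha>)) powr \<alpha> < t"
      unfolding t_def using far assms(1) by (intro powr_less_mono2) auto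
    then have "T < t"
      using T assms(1) by (simp add: powr_powr)
    then have t: "t \<ge> 1" "2 * A / a \<le> t"
      using T by auto
    have "2 * A \<le> a * t"
      using t(2) assms(2) by (simp add: field_simps)
    moreover have "B * t \<le> \<bar>B\<bar> * t"
      using t(1) by (intro mult_right_mono) auto
    moreover have "A \<le> A * t"
      using t(1) assms(3) by (simp add: mult_le_cancel_left1)
    moreover have "0 \<le> a * t"
      using t(1) assms(2) by simp
    ultimately show ?thesis
      using lower[OF that(1)] upper[OF that(1)]
      unfolding t_def[symmetric] distrib_right by linarith
  qed
  moreover have "0 < a / 2" "a / 2 < \<bar>B\<bar> + A + a" "0 < T powr (1 / \<alpha>)"
    using assms T by auto
  ultimately show ?thesis
    unfolding asymp_equiv_on_def by blast
qed

lemma affine_bounds_of_asymp_equiv_on: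
  fixes g0 :: "real \<Rightarrow> real"
  assumes "\<alpha> \<ge> 0" and cont: "continuous_on {0..} g0"
    and nonneg: "\<And>t. t \<ge> 0 \<Longrightarrow> g0 t \<ge> 0"
    and equiv: "asymp_equiv_on {0..} g0 (\<lambda>t. \<bar>t\<bar> powr \<alpha>)"
  shows "\<exists>c C M. c > 0 \<and> C > 0 \<and>
    (\<forall>t\<ge>0. c * t powr \<alpha> - M \<le> g0 t \<and> g0 t \<le> C * t powr \<alpha> + M)"
proof -
  obtain c C x0 where c: "0 < c" "c < C" "0 < x0"
    and far: "\<And>t. t \<ge> 0 \<Longrightarrow> t > x0 \<Longrightarrow> c * t powr \<alpha> \<le> g0 t \<and> g0 t \<le> C * t powr \<alpha>"
    using equiv by (auto simp: asymp_equiv_on_def)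
  have "bounded (g0 ` {0..x0})"
    by (intro compact_imp_bounded compact_continuous_image continuous_on_subset[OF cont]) auto
  then obtain N where "\<forall>t\<in>{0..x0}. \<bar>g0 t\<bar> \<le> N"
    by (auto simp: bounded_iff)
  then have N: "\<bar>g0 t\<bar> \<le> N" if "0 \<le> t" "t \<le> x0" for t
    using that by simp
  define M where "M = \<bar>N\<bar> + c * x0 powr \<alpha>"
  have "0 \<le> c * x0 powr \<alpha>"
    using c by simp
  then have M: "M \<ge> 0" "N \<le> M" "c * x0 powr \<alpha> \<le> M"
    unfolding M_def by linarith+
  have "c * t powr \<alpha> - M \<le> g0 t \<and> g0 t \<le> C * t powr \<alpha> + M" if "t \<ge> 0" for t
  proof (cases "t > x0")
    case True
    then show ?thesis
      using far[OF that] M(1) by auto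
  next
    case False
    then have "c * t powr \<alpha> \<le> c * x0 powr \<alpha>"
      using that assms(1) c(1) by (intro mult_left_mono powr_mono2) auto
    moreover have "0 \<le> C * t powr \<alpha>"
      using c by simp
    ultimately show ?thesis
      using N[OF that] False nonneg[OF that] M by auto
  qed
  then show ?thesis
    using c by (intro exI[of _ c] exI[of _ C] exI[of _ M]) auto
qed

text \<open>
  A nonzero space contains a ray isometric to \<open>{0..}\<close>, along which the kernel is a copy of its
  radial profile. In the zero space, \<open>g0\<close> is determined at \<open>0\<close> only, hence the unit vector.
\<close>

lemma radial_profile_continuous:
  fixes g :: "'a::real_normed_vector \<Rightarrow> 'a \<Rightarrow> real"
  assumes cont: "continuous_on UNIV (\<lambda>(x, y). g x y)"
    and radial: "\<And>x y. g x y = g0 (norm (x - y))"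
    and "norm (u :: 'a) = 1"
  shows "continuous_on {0..} g0"
proof -
  have "continuous_on {0..} (\<lambda>t::real. (\<lambda>(x, y). g x y) (t *\<^sub>R u, 0))"
    by (intro continuous_on_compose2[OF cont] continuous_intros) auto
  then show ?thesis
    by (rule continuous_on_eq) (simp add: radial assms(3))
qed

section \<open>Growth of the potential and of the kernel score\<close>

lemma potential_affine_bounds:
  fixes P :: "'a::real_normed_vector measure"
  assumes "prob_space P" and sets: "sets P = sets borel"
    and meas: "\<And>y. (\<lambda>x. g0 (norm (x - y))) \<in> borel_measurable P"
    and int: "integrable P (\<lambda>x. g0 (norm x))"
    and "\<alpha> \<ge> 0" and c: "c > 0" "C > 0"
    and bounds: "\<forall>t\<ge>0. c * t powr \<alpha> - M \<le> g0 t \<and> g0 t \<le> C * t powr \<alpha> + M"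
  obtains a A B where "a > 0" "A \<ge> 0"
    and "\<And>y. a * norm y powr \<alpha> - A \<le> (\<integral>x. g0 (norm (x - y)) \<partial>P)"
    and "\<And>y. (\<integral>x. g0 (norm (x - y)) \<partial>P) \<le> B * norm y powr \<alpha> + A"
proof -
  interpret prob_space P by fact
  have lower: "c * t powr \<alpha> - M \<le> g0 t" and upper: "g0 t \<le> C * t powr \<alpha> + M"
    if "t \<ge> 0" for t
    using bounds that by simp_all
  define D :: real where "D = 2 powr \<alpha>"
  have D: "D > 0"
    by (simp add: D_def)
  have norm_meas: "(\<lambda>x. norm x powr \<alpha>) \<in> borel_measurable P"
    unfolding measurable_cong_sets[OF sets refl] by measurable
  have moment: "integrable P (\<lambda>x. norm x powr \<alpha>)"
  proof (rule Bochner_Integration.integrable_bound)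
    show "integrable P (\<lambda>x. (g0 (norm x) + M) / c)"
      using int by simp
    have "norm x powr \<alpha> \<le> (g0 (norm x) + M) / c" for x :: 'a
      using lower[of "norm x"] c by (simp add: field_simps)
    then show "AE x in P. norm (norm x powr \<alpha>) \<le> norm ((g0 (norm x) + M) / c)"
      by (intro AE_I2) (metis abs_ge_self order_trans powr_ge_zero real_norm_def abs_of_nonneg)
  qed (rule norm_meas)
  define m where "m = (\<integral>x. norm x powr \<alpha> \<partial>P)"
  have m: "m \<ge> 0"
    by (simp add: m_def)
  have pointwise:
    "c * (norm y powr \<alpha> / D - norm x powr \<alpha>) - M \<le> g0 (norm (x - y))"
    "g0 (norm (x - y)) \<le> C * (D * (norm x powr \<alpha> + norm y powr \<alpha>)) + M" for x y :: 'a
  proof -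
    have "norm y powr \<alpha> \<le> D * (norm x powr \<alpha> + norm (x - y) powr \<alpha>)"
      using norm_add_powr_le[OF assms(5), of x "y - x"] by (simp add: D_def norm_minus_commute)
    then have "norm y powr \<alpha> / D - norm x powr \<alpha> \<le> norm (x - y) powr \<alpha>"
      using D by (simp add: field_simps)
    then have "c * (norm y powr \<alpha> / D - norm x powr \<alpha>) \<le> c * norm (x - y) powr \<alpha>"
      using c by (intro mult_left_mono) auto
    with lower[of "norm (x - y)"]
    show "c * (norm y powr \<alpha> / D - norm x powr \<alpha>) - M \<le> g0 (norm (x - y))"
      by simp
    have "norm (x - y) powr \<alpha> \<le> D * (norm x powr \<alpha> + norm y powr \<alpha>)"
      using norm_add_powr_le[OF assms(5), of x "- y"] by (simp add: D_def)
    then have "C * norm (x - y) powr \<alpha> \<le> C * (D * (norm x powr \<alpha> + norm y powr \<alpha>))"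
      using c by (intro mult_left_mono) auto
    with upper[of "norm (x - y)"]
    show "g0 (norm (x - y)) \<le> C * (D * (norm x powr \<alpha> + norm y powr \<alpha>)) + M"
      by simp
  qed
  have lower_int: "integrable P (\<lambda>x. c * (norm y powr \<alpha> / D - norm x powr \<alpha>) - M)"
    and upper_int: "integrable P (\<lambda>x. C * (D * (norm x powr \<alpha> + norm y powr \<alpha>)) + M)" for y :: 'a
    using moment by auto
  have g_int: "integrable P (\<lambda>x. g0 (norm (x - y)))" for y
  proof (rule Bochner_Integration.integrable_bound)
    show "integrable P (\<lambda>x. \<bar>c * (norm y powr \<alpha> / D - norm x powr \<alpha>) - M\<bar>
        + \<bar>C * (D * (norm x powr \<alpha> + norm y powr \<alpha>)) + M\<bar>)"
      by (rule Bochner_Integration.integrable_add[OF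
          integrable_abs[OF lower_int] integrable_abs[OF upper_int]])
    show "AE x in P. norm (g0 (norm (x - y)))
        \<le> norm (\<bar>c * (norm y powr \<alpha> / D - norm x powr \<alpha>) - M\<bar>
          + \<bar>C * (D * (norm x powr \<alpha> + norm y powr \<alpha>)) + M\<bar>)"
    proof (intro AE_I2)
      fix x
      show "norm (g0 (norm (x - y)))
        \<le> norm (\<bar>c * (norm y powr \<alpha> / D - norm x powr \<alpha>) - M\<bar>
          + \<bar>C * (D * (norm x powr \<alpha> + norm y powr \<alpha>)) + M\<bar>)"
        using pointwise(1)[of y x] pointwise(2)[of x y] unfolding real_norm_def by arith
    qed
  qed (rule meas)
  define A where "A = \<bar>c * m + M\<bar> + \<bar>C * D * m + M\<bar>"
  have "c / D * norm y powr \<alpha> - A \<le> (\<integral>x. g0 (norm (x - y)) \<partial>P)" for y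
  proof -
    have "(\<integral>x. c * (norm y powr \<alpha> / D - norm x powr \<alpha>) - M \<partial>P)
        = c / D * norm y powr \<alpha> - (c * m + M)"
      using moment by (simp add: m_def prob_space algebra_simps)
    moreover have "(\<integral>x. c * (norm y powr \<alpha> / D - norm x powr \<alpha>) - M \<partial>P)
        \<le> (\<integral>x. g0 (norm (x - y)) \<partial>P)"
      by (intro integral_mono lower_int g_int pointwise)
    ultimately show ?thesis
      by (simp add: A_def)
  qed
  moreover have "(\<integral>x. g0 (norm (x - y)) \<partial>P) \<le> C * D * norm y powr \<alpha> + A" for y
  proof -
    have "(\<integral>x. C * (D * (norm x powr \<alpha> + norm y powr \<alpha>)) + M \<partial>P)
        = C * D * norm y powr \<alpha> + (C * D * m + M)"
      using moment by (simp add: m_def prob_space algebra_simps)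
    moreover have "(\<integral>x. g0 (norm (x - y)) \<partial>P)
        \<le> (\<integral>x. C * (D * (norm x powr \<alpha> + norm y powr \<alpha>)) + M \<partial>P)"
      by (intro integral_mono upper_int g_int pointwise)
    ultimately show ?thesis
      by (simp add: A_def)
  qed
  moreover have "c / D > 0" "A \<ge> 0"
    using c D by (auto simp: A_def)
  ultimately show thesis
    by (intro that[of "c / D" A "C * D"])
qed

theorem theorem2:
  fixes P :: "'a::real_normed_vector measure"
    and g :: "'a \<Rightarrow> 'a \<Rightarrow> real"
    and g0 :: "real \<Rightarrow> real"
    and \<alpha> :: real
  assumes "prob_space P" and "sets P = sets borel"
    and "\<And>x y. 0 \<le> g x y"
    and "continuous_on UNIV (\<lambda>(x, y). g x y)"
    and "negative_definite_kernel UNIV g"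
    and "\<And>x y. g x y = g0 (norm (x - y))"
    and "\<alpha> > 0"
    and "asymp_equiv_on {0..} g0 (\<lambda>t. \<bar>t\<bar> powr \<alpha>)"
    and "integrable P (\<lambda>x. g0 (norm x))"
  shows "asymp_equiv_on UNIV (\<lambda>y. \<bar>kernel_score g P y\<bar>) (\<lambda>y. norm y powr \<alpha>)"
proof (cases "\<exists>v :: 'a. v \<noteq> 0")
  case False
  \<comment> \<open>The zero space has no points of large norm.\<close>
  have "\<not> norm y > 1" for y :: 'a
  proof -
    have "y = 0"
      using False by blast
    then show ?thesis
      by simp
  qed
  then show ?thesis
    unfolding asymp_equiv_on_def by (intro exI[of _ 1] exI[of _ 2] conjI) auto
next
  case True
  then obtain v :: 'a where "v \<noteq> 0"
    by blast
  define u where "u = v /\<^sub>R norm v"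
  have u: "norm u = 1"
    using \<open>v \<noteq> 0\<close> by (simp add: u_def)
  have cont: "continuous_on {0..} g0"
    using assms(4,6) u by (rule radial_profile_continuous)
  have nonneg: "g0 t \<ge> 0" if "t \<ge> 0" for t
    using assms(3)[of "t *\<^sub>R u" 0] that by (simp add: assms(6) u)
  have "\<exists>c C M. c > 0 \<and> C > 0 \<and>
    (\<forall>t\<ge>0. c * t powr \<alpha> - M \<le> g0 t \<and> g0 t \<le> C * t powr \<alpha> + M)"
    by (rule affine_bounds_of_asymp_equiv_on[OF less_imp_le[OF assms(7)] cont nonneg assms(8)])
  then obtain c C M where bounds: "c > 0" "C > 0"
    "\<forall>t\<ge>0. c * t powr \<alpha> - M \<le> g0 t \<and> g0 t \<le> C * t powr \<alpha> + M"
    by (elim exE conjE)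
  have meas: "(\<lambda>x. g0 (norm (x - y))) \<in> borel_measurable P" for y :: 'a
  proof -
    have "continuous_on UNIV (\<lambda>x. g0 (norm (x - y)))"
      by (intro continuous_on_compose2[OF cont] continuous_intros) auto
    then show ?thesis
      unfolding measurable_cong_sets[OF assms(2) refl]
      by (rule borel_measurable_continuous_onI)
  qed
  obtain a A B where a: "a > 0" "A \<ge> 0"
    and pot: "\<And>y. a * norm y powr \<alpha> - A \<le> (\<integral>x. g0 (norm (x - y)) \<partial>P)"
      "\<And>y. (\<integral>x. g0 (norm (x - y)) \<partial>P) \<le> B * norm y powr \<alpha> + A"
    using potential_affine_bounds[OF assms(1,2) meas assms(9) less_imp_le[OF assms(7)] bounds]
    by blast
  define K where "K = 1 / 2 * (\<integral>z. g (fst z) (snd z) \<partial>(P \<Otimes>\<^sub>M P))"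
  have score: "kernel_score g P y = K - (\<integral>x. g0 (norm (x - y)) \<partial>P)" for y
    by (simp add: kernel_score_def K_def assms(6))
  \<comment> \<open>The potential may be negative as far as its bounds tell, so the upper bound for the
    absolute value uses both of them, with leading coefficient \<open>\<bar>B\<bar>\<close>.\<close>
  show ?thesis
  proof (rule asymp_equiv_on_of_affine_bounds[OF assms(7) a(1), of "A + \<bar>K\<bar>" _ _ "\<bar>B\<bar>"])
    show "0 \<le> A + \<bar>K\<bar>"
      using a by simp
    fix y :: 'a
    show "a * norm y powr \<alpha> - (A + \<bar>K\<bar>) \<le> \<bar>kernel_score g P y\<bar>"
      using pot(1)[of y] unfolding score by linarith
    have "0 \<le> a * norm y powr \<alpha>" "0 \<le> \<bar>B\<bar> * norm y powr \<alpha>"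
      "B * norm y powr \<alpha> \<le> \<bar>B\<bar> * norm y powr \<alpha>"
      using a by (auto intro: mult_right_mono)
    then show "\<bar>kernel_score g P y\<bar> \<le> \<bar>B\<bar> * norm y powr \<alpha> + (A + \<bar>K\<bar>)"
      using pot[of y] unfolding score by linarith
  qed
qed

end
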